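(* Let $G$ be a finite simple graph without isolated vertices that is one of the following: (a) a graph with no cycle of length bigger than $5$; (b) a claw-free chordal graph. Then $\widetilde{G}$ is a chordal graph.
   Context: $\widetilde{G}$ is the second power of $G$: the graph with vertex set $V(G)$ and edge set $E(\widetilde{G})=E(G)\cup\{\{i,j\}: i\ne j,\ i,j\in N_G(p)\text{ for some }p\in V(G)\}$, where $N_G(p)$ is the open neighborhood of $p$. In (a), cycles are not required to be induced. A graph is claw-free if it has no induced subgraph isomorphic to the complete bipartite graph $K_{1,3}$. *)

theory Defs
  imports "Graph_Theory.Graph_Theory"
begin

text \<open>
  Finite simple graphs are the finite, loopfree, symmetric digraphs of the locale
  \<^locale>\<open>pair_graph\<close>: an undirected edge is represented by both of its orientations.
\<close>

definition open_neighborhood :: "'a pair_pre_digraph \<Rightarrow> 'a \<Rightarrow> 'a set" where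
  "open_neighborhood G p = {v \<in> pverts G. (p, v) \<in> parcs G}"

definition no_isolated_vertices :: "'a pair_pre_digraph \<Rightarrow> bool" where
  "no_isolated_vertices G \<longleftrightarrow> (\<forall>v \<in> pverts G. open_neighborhood G v \<noteq> {})"

definition second_power :: "'a pair_pre_digraph \<Rightarrow> 'a pair_pre_digraph" where
  "second_power G = \<lparr> pverts = pverts G,
     parcs = parcs G \<union> {(i, j). i \<noteq> j \<and>
       (\<exists>p \<in> pverts G. i \<in> open_neighborhood G p \<and> j \<in> open_neighborhood G p)} \<rparr>"

text \<open>
  The library's \<^const>\<open>pre_digraph.cycle\<close> is a closed arc walk without repeated vertices. In a
  symmetric digraph it also admits the closed walks $u, v, u$ of length $2$; those of length
  at least $3$ are exactly the (rooted, oriented) cycles of the undirected graph. The vertices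
  of such an arc list are the tails of its arcs, and its number of arcs is the length of the cycle.
  A chord is an edge of the graph joining two vertices of the cycle that, in neither orientation,
  is an edge of the cycle.
\<close>

definition has_chord :: "'a pair_pre_digraph \<Rightarrow> ('a \<times> 'a) awalk \<Rightarrow> bool" where
  "has_chord G c \<longleftrightarrow> (\<exists>u \<in> fst ` set c. \<exists>v \<in> fst ` set c.
     (u, v) \<in> parcs G \<and> (u, v) \<notin> set c \<and> (v, u) \<notin> set c)"

definition chordal :: "'a pair_pre_digraph \<Rightarrow> bool" where
  "chordal G \<longleftrightarrow>
     (\<forall>c. pre_digraph.cycle (with_proj G) c \<and> length c \<ge> 4 \<longrightarrow> has_chord G c)"

definition claw_free :: "'a pair_pre_digraph \<Rightarrow> bool" where
  "claw_free G \<longleftrightarrow>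
     \<not> (\<exists>H :: ('a, 'a \<times> 'a) pre_digraph. induced_subgraph H (with_proj G) \<and> K\<^bsub>1,3\<^esub> H)"

end

theory Submission
  imports Defs
begin

text \<open>
  Suppose the second power of $G$ has a chordless cycle $v_0, \ldots, v_{k-1}$ with $k \ge 4$
  (a ``hole''). Consecutive vertices are adjacent in $G$ or have a common neighbour, so every
  pair $v_i, v_{i+1}$ that is not an edge of $G$ can be joined through a common neighbour
  $m_i$. All neighbours of a single vertex are pairwise adjacent in the second power. As the
  hole has no chord and at least four vertices, it contains no three vertices that are pairwise
  adjacent in the second power. Hence the only vertices of the hole adjacent to $m_i$ are $v_i$ and
  $v_{i+1}$, the $m_i$ are distinct from each other and from all $v_j$, and two consecutive
  edges of the hole are never both edges of $G$. Inserting the $m_i$ thus turns the hole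
  into a genuine cycle of $G$.

  In case (a) the length of this cycle gives the contradiction: among any two consecutive edges
  of the hole at least one is subdivided, which gives at least two new vertices, and $4 + 2 > 5$.

  In case (b) consider the chords of this cycle. Chords at a $v_j$ are excluded
  by the above. If $m_i$ and $m_j$ are adjacent while $i, j$ are not consecutive, then $m_i$
  with $v_i$, $v_{i+1}$, $m_j$ is a claw. So every chord has the form $m_i m_{i+1}$, and taking all
  these short cuts at once, skipping the vertices $v_{i+1}$ they bypass, leaves a chordless
  cycle of $G$. It contains at least one vertex for each index, so its length is at least
  $k \ge 4$, against the chordality of $G$.

  Both cycles are instances of one construction, parametrised by the set \<open>D\<close> of skipped
  vertices: the cycle for (a) takes \<open>D\<close> empty.
\<close>

section \<open>Cycles as closed arc lists\<close>

text \<open>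
  Cycles are specified by distinctness of the heads of their arcs, whereas chords and the
  constructions below speak about tails. On a closed arc list the two multisets agree,
  since every arc contributes its head to the next tail.
\<close>

lemma mset_fst_snd_if_pcas:
  assumes "pcas u c w"
  shows "add_mset w (mset (map fst c)) = add_mset u (mset (map snd c))"
  using assms by (induct u c w rule: pcas.induct) (auto simp: add_mset_commute)

lemma mset_fst_eq_snd_if_closed:
  assumes "pcas u c u"
  shows "mset (map fst c) = mset (map snd c)"
  using mset_fst_snd_if_pcas[OF assms] by simp

lemma pair_cycle_iff:
  "pre_digraph.cycle (with_proj G) c \<longleftrightarrow>
    c \<noteq> [] \<and> fst (hd c) \<in> pverts G \<and> set c \<subseteq> parcs G \<and> pcas (fst (hd c)) c (fst (hd c))
    \<and> distinct (map fst c)"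
proof -
  have verts: "tl (pawalk_verts u c) = map snd c" if "pcas u c u" for u
  proof -
    have "pawalk_verts u' c = u' # map snd c" if "pcas u' c w" for u' w
      using that by (induct u' c w rule: pcas.induct) auto
    then show ?thesis using that by fastforce
  qed
  have dist: "distinct (map snd c) = distinct (map fst c)" if "pcas u c u" for u
    using mset_fst_eq_snd_if_closed[OF that] mset_eq_imp_distinct_iff by metis
  have start: "u = fst (hd c)" if "pcas u c u" "c \<noteq> []" for u
    using that by (cases c) auto
  show ?thesis
    unfolding pre_digraph.cycle_def pre_digraph.awalk_def
      cas_with_proj_eq awalk_verts_with_proj_eq with_proj_simps
    using verts dist start by metis
qed

lemma pcas_appendI: "pcas u p x \<Longrightarrow> pcas x q w \<Longrightarrow> pcas u (p @ q) w"
  by (induct p arbitrary: u) auto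

lemma pcas_nth:
  assumes "pcas u c w" "i < length c"
  shows "snd (c ! i) = (if Suc i < length c then fst (c ! Suc i) else w)"
  using assms
proof (induct u c w arbitrary: i rule: pcas.induct)
  case (2 u e es w)
  then show ?case by (cases i; cases es) auto
qed simp

lemma closed_arc_list_nth:
  assumes "pcas (fst (hd c)) c (fst (hd c))" "i < length c"
  shows "c ! i = (fst (c ! i), fst (c ! (Suc i mod length c)))"
proof -
  have "snd (c ! i) = fst (c ! (Suc i mod length c))"
  proof (cases "Suc i < length c")
    case False
    then have "Suc i = length c" using assms(2) by simp
    moreover have "c \<noteq> []" using assms(2) by auto
    ultimately show ?thesis using pcas_nth[OF assms] by (simp add: hd_conv_nth)
  qed (use pcas_nth[OF assms] in simp)
  then show ?thesis by (metis prod.collapse)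
qed

section \<open>Claws\<close>

lemma (in pair_graph) arcs_sym: "(x, y) \<in> parcs G \<Longrightarrow> (y, x) \<in> parcs G"
  using pair_sym_arcs unfolding symmetric_def sym_def by simp

lemma (in pair_graph) no_loop: "(x, x) \<notin> parcs G"
  using pair_no_loops by fastforce

lemma (in pair_graph) claw_free_neighbours:
  assumes "claw_free G"
    and "(p, x) \<in> parcs G" "(p, y) \<in> parcs G" "(p, z) \<in> parcs G"
    and "x \<noteq> y" "x \<noteq> z" "y \<noteq> z"
  shows "(x, y) \<in> parcs G \<or> (x, z) \<in> parcs G \<or> (y, z) \<in> parcs G"
proof (rule ccontr)
  assume indep: "\<not> ?thesis"
  define H where "H = \<lparr> pverts = {p, x, y, z}, parcs = {p} \<times> {x, y, z} \<union> {x, y, z} \<times> {p} \<rparr>"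
  have ne: "p \<noteq> x" "p \<noteq> y" "p \<noteq> z" using assms no_loop by auto
  have "K\<^bsub>1,3\<^esub> (with_proj H)"
    unfolding complete_bipartite_digraph_pair_def
  proof (intro conjI exI)
    show "finite (pverts H)" "pverts H = {p} \<union> {x, y, z}"
      "parcs H = {p} \<times> {x, y, z} \<union> {x, y, z} \<times> {p}" by (auto simp: H_def)
    show "{p} \<inter> {x, y, z} = {}" using ne by simp
    show "card {p} = 1" "card {x, y, z} = 3" using assms(5-7) by simp_all
  qed
  moreover have "induced_subgraph (with_proj H) (with_proj G)"
  proof -
    have rev: "(x, p) \<in> parcs G" "(y, p) \<in> parcs G" "(z, p) \<in> parcs G"
      using assms(2-4) arcs_sym by simp_all
    have indep': "(y, x) \<notin> parcs G" "(z, x) \<notin> parcs G" "(z, y) \<notin> parcs G"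
      using indep arcs_sym by blast+
    have "(a, b) \<in> parcs H \<longleftrightarrow> (a, b) \<in> parcs G \<and> a \<in> pverts H \<and> b \<in> pverts H" for a b
      using indep indep' rev assms(2-4) no_loop by (simp add: H_def) metis
    then have "parcs H = {e \<in> parcs G. fst e \<in> pverts H \<and> snd e \<in> pverts H}"
      by auto
    moreover have "wf_digraph (with_proj H)"
      unfolding wf_digraph_wp_iff by unfold_locales (auto simp: H_def)
    moreover have "wf_digraph (with_proj G)" by unfold_locales
    moreover have "pverts H \<subseteq> pverts G"
      using assms(2-4) by (auto simp: H_def dest: in_arcsD1 in_arcsD2)
    ultimately show ?thesis
      unfolding induced_subgraph_def subgraph_def compatible_def by auto
  qed
  ultimately show False using assms(1) unfolding claw_free_def by blast
qed

section \<open>A chordless cycle of the second power\<close>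

text \<open>
  The vertices of the hole are indexed by $0, \ldots, k - 1$, read modulo $k$.
\<close>

locale square_hole = pair_graph G for G :: "'a pair_pre_digraph" +
  fixes v :: "nat \<Rightarrow> 'a" and k :: nat
  assumes k: "4 \<le> k"
    and inj_v: "inj_on v {..<k}"
    and edge: "i < k \<Longrightarrow> (v i, v (Suc i mod k)) \<in> parcs (second_power G)"
    and chordless: "\<lbrakk> i < k; j < k; (v i, v j) \<in> parcs (second_power G) \<rbrakk>
      \<Longrightarrow> j = Suc i mod k \<or> i = Suc j mod k"
begin

definition nxt :: "nat \<Rightarrow> nat" where
  "nxt i = Suc i mod k"

lemma nxt_less [simp]: "nxt i < k"
  using k by (simp add: nxt_def)

lemma
  assumes "i < k"
  shows nxt1: "nxt i \<noteq> i" and nxt2: "nxt (nxt i) \<noteq> i" and nxt3: "nxt (nxt (nxt i)) \<noteq> i"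
  using assms k by (auto simp: nxt_def mod_Suc split: if_splits)

lemma nxt_inj: "i < k \<Longrightarrow> j < k \<Longrightarrow> nxt i = nxt j \<longleftrightarrow> i = j"
  by (auto simp: nxt_def mod_Suc split: if_splits)

lemma v_eq_iff: "i < k \<Longrightarrow> j < k \<Longrightarrow> v i = v j \<longleftrightarrow> i = j"
  using inj_v by (auto simp: inj_on_def)

definition consec :: "nat \<Rightarrow> nat \<Rightarrow> bool" where
  "consec i j \<longleftrightarrow> j = nxt i \<or> i = nxt j"

text \<open>
  A vertex next to both ends of an edge would close a triangle, and a cycle with at least four
  vertices contains none.
\<close>

lemma not_consec_both:
  assumes "i < k" "j < k" "consec i j" "consec (nxt i) j"
  shows False
  using assms nxt1 nxt2 nxt3 nxt_inj unfolding consec_def by (metis nxt_less)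

lemma consec_if_arc:
  assumes "i < k" "j < k" "(v i, v j) \<in> parcs G"
  shows "consec i j"
  using chordless[OF assms(1,2)] assms(3) by (auto simp: second_power_def consec_def nxt_def)

text \<open>
  Neighbours of a common vertex are adjacent in the second power, so the absence of chords
  forces them to be consecutive.
\<close>

lemma consec_if_common_neighbour:
  assumes "i < k" "j < k" "i \<noteq> j" "(p, v i) \<in> parcs G" "(p, v j) \<in> parcs G"
  shows "consec i j"
proof -
  have "(v i, v j) \<in> parcs (second_power G)"
    using assms v_eq_iff in_arcsD1 in_arcsD2
    unfolding second_power_def open_neighborhood_def by fastforce
  then show ?thesis using chordless[OF assms(1,2)] by (auto simp: consec_def nxt_def)
qed

definition direct :: "nat \<Rightarrow> bool" where
  "direct i \<longleftrightarrow> (v i, v (nxt i)) \<in> parcs G"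

text \<open>
  Only meaningful at indices that are not direct; then the definition of the second power
  provides such a common neighbour.
\<close>

definition mid :: "nat \<Rightarrow> 'a" where
  "mid i = (SOME p. (p, v i) \<in> parcs G \<and> (p, v (nxt i)) \<in> parcs G)"

lemma mid:
  assumes "i < k" "\<not> direct i"
  shows "(mid i, v i) \<in> parcs G" "(mid i, v (nxt i)) \<in> parcs G"
proof -
  have "\<exists>p. (p, v i) \<in> parcs G \<and> (p, v (nxt i)) \<in> parcs G"
    using edge[OF assms(1)] assms(2)
    by (auto simp: direct_def second_power_def open_neighborhood_def nxt_def)
  from someI_ex[OF this] show "(mid i, v i) \<in> parcs G" "(mid i, v (nxt i)) \<in> parcs G"
    unfolding mid_def by auto
qed

text \<open>
  A further neighbour \<open>v j\<close> of \<open>mid i\<close> would share it with both \<open>v i\<close> and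
  \<open>v (nxt i)\<close>, and so be consecutive to both.
\<close>

lemma mid_neighbours:
  assumes "i < k" "\<not> direct i" "j < k" "(mid i, v j) \<in> parcs G"
  shows "j = i \<or> j = nxt i"
  using assms mid consec_if_common_neighbour not_consec_both nxt_less by metis

lemma mid_neq_v:
  assumes "i < k" "\<not> direct i" "j < k"
  shows "mid i \<noteq> v j"
  using assms mid consec_if_arc not_consec_both unfolding consec_def by (metis nxt_less)

lemma mid_eq_iff:
  assumes "i < k" "\<not> direct i" "j < k" "\<not> direct j"
  shows "mid i = mid j \<longleftrightarrow> i = j"
  using assms mid mid_neighbours nxt1 nxt2 nxt_less by metis

text \<open>
  The middle vertex of two consecutive edges of $G$ would be a common neighbour of two
  vertices that are not consecutive on the hole.
\<close>

lemma no_two_direct: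
  assumes "i < k" "direct i" "direct (nxt i)"
  shows False
proof -
  have "consec i (nxt (nxt i))"
    using assms nxt2[of i] consec_if_common_neighbour[of i "nxt (nxt i)" "v (nxt i)"]
      arcs_sym[of "v i" "v (nxt i)"]
    unfolding direct_def by simp
  then show False
    using assms nxt1 nxt3 unfolding consec_def by (metis nxt_less)
qed

text \<open>
  The neighbours \<open>v i\<close>, \<open>v (nxt i)\<close> and \<open>mid j\<close> of \<open>mid i\<close> do not form a claw. The first
  two are not adjacent as \<open>i\<close> is not direct, so \<open>mid j\<close> is adjacent to one of them, which
  must then be \<open>v j\<close> or \<open>v (nxt j)\<close>.
\<close>

lemma consec_if_mid_arc:
  assumes "claw_free G" "i < k" "\<not> direct i" "j < k" "\<not> direct j" "(mid i, mid j) \<in> parcs G"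
  shows "consec i j"
proof -
  have "(v i, v (nxt i)) \<in> parcs G \<or> (v i, mid j) \<in> parcs G \<or> (v (nxt i), mid j) \<in> parcs G"
    using assms mid mid_neq_v[of j i] mid_neq_v[of j "nxt i"] nxt1[of i] v_eq_iff
    by (intro claw_free_neighbours[of "mid i"]) (auto simp: eq_commute)
  then have "(mid j, v i) \<in> parcs G \<or> (mid j, v (nxt i)) \<in> parcs G"
    using assms(3) arcs_sym unfolding direct_def by blast
  moreover have "i \<noteq> j" using assms(6) no_loop by auto
  ultimately show ?thesis
    using mid_neighbours[of j i] mid_neighbours[of j "nxt i"] assms nxt_inj
    unfolding consec_def by auto
qed

end

section \<open>Lifting the hole to a cycle of the graph\<close>

text \<open>
  \<open>D\<close> is the set of indices whose hole vertex is skipped: \<open>v (nxt i)\<close> may be bypassed when it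
  lies between two adjacent intermediate vertices, which then become neighbours on the cycle.
\<close>

locale lifted_hole = square_hole +
  fixes D :: "nat set"
  assumes D: "\<lbrakk> i < k; nxt i \<in> D \<rbrakk>
    \<Longrightarrow> \<not> direct i \<and> \<not> direct (nxt i) \<and> (mid i, mid (nxt i)) \<in> parcs G"
begin

text \<open>
  Each index contributes a nonempty stretch of the cycle; \<open>entry i\<close> is its first vertex and
  \<open>block i\<close> lists the arcs from there to the first vertex of the next stretch.
\<close>

definition entry :: "nat \<Rightarrow> 'a" where
  "entry i = (if i \<in> D then mid i else v i)"

definition block :: "nat \<Rightarrow> ('a \<times> 'a) list" where
  "block i = (if direct i then [(v i, entry (nxt i))]
     else if i \<in> D then [(mid i, entry (nxt i))]
     else [(v i, mid i), (mid i, entry (nxt i))])"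

definition tour :: "('a \<times> 'a) list" where
  "tour = concat (map block [0..<k])"

lemma D_not_direct: "i < k \<Longrightarrow> i \<in> D \<Longrightarrow> \<not> direct i"
proof -
  assume i: "i < k" "i \<in> D"
  \<comment> \<open>the assumption on \<open>D\<close> is stated for successors, so it is applied to the predecessor of \<open>i\<close>\<close>
  have "\<exists>j<k. nxt j = i"
    using i(1) k by (intro exI[of _ "if i = 0 then k - 1 else i - 1"]) (auto simp: nxt_def)
  then show ?thesis using D i(2) by blast
qed

lemma block_not_Nil: "block i \<noteq> []"
  by (simp add: block_def)

lemma block_pcas: "i < k \<Longrightarrow> pcas (entry i) (block i) (entry (nxt i))"
  using D_not_direct by (auto simp: block_def entry_def)

text \<open>
  Reducing \<open>n\<close> modulo \<open>k\<close> makes the walk return to its start at \<open>n = k\<close>.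
\<close>

lemma tour_pcas: "n \<le> k \<Longrightarrow> pcas (entry 0) (concat (map block [0..<n])) (entry (n mod k))"
proof (induct n)
  case (Suc n)
  then have "pcas (entry 0) (concat (map block [0..<n])) (entry n)"
    "pcas (entry n) (block n) (entry (Suc n mod k))"
    using block_pcas[of n] by (simp_all add: nxt_def)
  from pcas_appendI[OF this] show ?case by simp
qed simp

lemma block_arcs: "i < k \<Longrightarrow> set (block i) \<subseteq> parcs G"
  using D[of i] mid[of i] by (auto simp: block_def entry_def direct_def dest: arcs_sym)

lemma fst_block: "x \<in> fst ` set (block i) \<longleftrightarrow> (x = v i \<and> (direct i \<or> i \<notin> D)) \<or> (x = mid i \<and> \<not> direct i)"
  by (auto simp: block_def)

lemma distinct_block: "i < k \<Longrightarrow> distinct (map fst (block i))"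
  using mid_neq_v[of i i] by (auto simp: block_def)

lemma distinct_tour: "n \<le> k \<Longrightarrow> distinct (map fst (concat (map block [0..<n])))"
proof (induct n)
  case (Suc n)
  have "fst ` set (block i) \<inter> fst ` set (block n) = {}" if "i < n" for i
  proof -
    have *: "i < k" "n < k" "i \<noteq> n" using that Suc.prems by auto
    show ?thesis
      using * mid_neq_v[of i n] mid_neq_v[of n i] mid_eq_iff[of i n] v_eq_iff[of i n]
      unfolding disjoint_iff fst_block by metis
  qed
  then have "set (map fst (concat (map block [0..<n]))) \<inter> set (map fst (block n)) = {}"
    by fastforce
  moreover have "distinct (map fst (concat (map block [0..<n])))" "distinct (map fst (block n))"
    using Suc distinct_block[of n] by simp_all
  ultimately show ?case by simp
qed simp

lemma length_blocks: "length xs \<le> length (concat (map block xs))"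
proof (induct xs)
  case (Cons i xs)
  have "1 \<le> length (block i)" using block_not_Nil[of i] by (simp add: Suc_le_eq)
  then show ?case using Cons by simp
qed simp

lemma length_tour: "k \<le> length tour"
  using length_blocks[of "[0..<k]"] by (simp add: tour_def)

lemma set_tour: "e \<in> set tour \<longleftrightarrow> (\<exists>i<k. e \<in> set (block i))"
  by (auto simp: tour_def)

lemma fst_tour: "x \<in> fst ` set tour \<longleftrightarrow> (\<exists>i<k. x \<in> fst ` set (block i))"
  by (auto simp: tour_def image_UN)

lemma cycle_tour: "pre_digraph.cycle (with_proj G) tour"
proof -
  have ne: "tour \<noteq> []" using length_tour k by auto
  have cas: "pcas (entry 0) tour (entry 0)" using tour_pcas[of k] by (simp add: tour_def)
  then have hd: "fst (hd tour) = entry 0" using ne by (cases tour) auto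
  have arcs: "set tour \<subseteq> parcs G" using set_tour block_arcs by blast
  then have "fst (hd tour) \<in> pverts G" using hd_in_set[OF ne] arc_fst_in_verts by blast
  moreover have "distinct (map fst tour)"
    using distinct_tour[OF order_refl] unfolding tour_def .
  moreover have "pcas (fst (hd tour)) tour (fst (hd tour))" using cas unfolding hd .
  ultimately show ?thesis using ne arcs pair_cycle_iff by blast
qed

end

section \<open>The two contradictions\<close>

text \<open>
  One of the indices 0, 1 and one of the indices 2, 3 is not direct, so the first four blocks
  already contain six arcs.
\<close>

lemma (in square_hole) long_cycle:
  "\<exists>c. pre_digraph.cycle (with_proj G) c \<and> 6 \<le> length c"
proof -
  interpret lifted_hole G v k "{}" by unfold_locales simp
  have "[0..<k] = [0..<4] @ [4..<k]"
    using k upt_add_eq_append[of 0 4 "k - 4"] by simp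
  moreover have "[0..<4] = [0, 1, 2, 3]" by (simp add: numeral_eq_Suc)
  ultimately have "tour = (block 0 @ block 1) @ (block 2 @ block 3) @ concat (map block [4..<k])"
    by (simp add: tour_def)
  moreover have "3 \<le> length (block 0 @ block 1)" "3 \<le> length (block 2 @ block 3)"
    using no_two_direct[of 0] no_two_direct[of 2] k by (auto simp: block_def nxt_def)
  ultimately have "6 \<le> length tour" by simp
  then show ?thesis using cycle_tour by blast
qed

text \<open>
  With every available short cut taken, the tour has no chord: an edge of $G$ between two hole
  vertices on it is direct, an edge at an intermediate vertex that leads to a hole vertex
  ends in the pair joined through it, and an edge between two intermediate vertices is
  one of the short cuts.
\<close>

lemma (in square_hole) not_chordal:
  assumes claw_free: "claw_free G"
  shows "\<not> chordal G"
proof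
  assume "chordal G"
  define D where "D = nxt ` {i. i < k \<and> \<not> direct i \<and> \<not> direct (nxt i) \<and> (mid i, mid (nxt i)) \<in> parcs G}"
  interpret lifted_hole G v k D
    by unfold_locales (auto simp: D_def nxt_inj)
  have "has_chord G tour"
    using \<open>chordal G\<close> cycle_tour length_tour k unfolding chordal_def by auto
  then obtain x y where x: "x \<in> fst ` set tour" and y: "y \<in> fst ` set tour"
    and xy: "(x, y) \<in> parcs G" and out: "(x, y) \<notin> set tour" "(y, x) \<notin> set tour"
    unfolding has_chord_def by blast
  from x obtain i where i: "i < k" "x \<in> fst ` set (block i)"
    unfolding fst_tour by blast
  from y obtain j where j: "j < k" "y \<in> fst ` set (block j)"
    unfolding fst_tour by blast
  have vv: "(v a, v (nxt a)) \<in> set tour" if "a < k" "direct a" for a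
    using that D[of a] set_tour by (auto simp: block_def entry_def)
  have vm: "(v a, mid a) \<in> set tour" if "a < k" "\<not> direct a" "a \<notin> D" for a
    using that set_tour by (auto simp: block_def)
  have mv: "(mid a, v (nxt a)) \<in> set tour" if "a < k" "\<not> direct a" "nxt a \<notin> D" for a
    using that set_tour by (auto simp: block_def entry_def)
  have mm: "(mid a, mid (nxt a)) \<in> set tour"
    if "a < k" "\<not> direct a" "\<not> direct (nxt a)" "(mid a, mid (nxt a)) \<in> parcs G" for a
  proof -
    have "nxt a \<in> D" using that unfolding D_def by blast
    then have "(mid a, mid (nxt a)) \<in> set (block a)"
      using that(2) by (simp add: block_def entry_def)
    then show ?thesis using that(1) set_tour by blast
  qed
  have mv': "(mid a, v b) \<in> set tour \<or> (v b, mid a) \<in> set tour"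
    if "a < k" "\<not> direct a" "b < k" "b \<notin> D" "(mid a, v b) \<in> parcs G" for a b
    using mid_neighbours[of a b] that vm mv by blast
  consider (both_v) "x = v i" "y = v j"
    | (v_mid) "x = v i" "i \<notin> D" "y = mid j" "\<not> direct j"
    | (mid_v) "x = mid i" "\<not> direct i" "y = v j" "j \<notin> D"
    | (both_mid) "x = mid i" "\<not> direct i" "y = mid j" "\<not> direct j"
    using i j D_not_direct unfolding fst_block by blast
  then show False
  proof cases
    case both_v
    then have "consec i j" using consec_if_arc i j xy by simp
    then show ?thesis
      using both_v xy out i j vv arcs_sym
      unfolding consec_def direct_def by blast
  next
    case v_mid
    then show ?thesis using mv'[of j i] xy out i j arcs_sym by blast
  next
    case mid_v
    then show ?thesis using mv'[of i j] xy out i j by blast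
  next
    case both_mid
    then have "consec i j" using consec_if_mid_arc[OF claw_free] i j xy by simp
    then show ?thesis
      using both_mid xy out i j mm arcs_sym
      unfolding consec_def by blast
  qed
qed

section \<open>Reading off a hole\<close>

lemma (in pair_graph) square_hole_if_not_chordal:
  assumes "\<not> chordal (second_power G)"
  shows "\<exists>v k. square_hole G v k"
proof -
  let ?H = "second_power G"
  obtain c where c: "pre_digraph.cycle (with_proj ?H) c" "4 \<le> length c" "\<not> has_chord ?H c"
    using assms unfolding chordal_def by blast
  define k where "k = length c"
  define v where "v i = fst (c ! i)" for i
  have nth: "c ! i = (v i, v (Suc i mod k))" if "i < k" for i
    using closed_arc_list_nth[of c i] c(1) that unfolding pair_cycle_iff v_def k_def by blast
  have "square_hole G v k"
  proof unfold_locales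
    show "4 \<le> k" using c(2) by (simp add: k_def)
    show "inj_on v {..<k}"
      using c(1) unfolding pair_cycle_iff v_def k_def inj_on_def by (auto simp: distinct_conv_nth)
    show "(v i, v (Suc i mod k)) \<in> parcs ?H" if "i < k" for i
      using c(1) nth[OF that] that nth_mem unfolding pair_cycle_iff k_def by (metis subsetD)
    have index: "\<exists>l<k. a = v l \<and> b = v (Suc l mod k)" if "(a, b) \<in> set c" for a b
      using that nth unfolding in_set_conv_nth k_def by force
    fix i j assume ij: "i < k" "j < k" "(v i, v j) \<in> parcs ?H"
    have "v i \<in> fst ` set c" "v j \<in> fst ` set c"
      using ij by (auto simp: v_def k_def)
    then have "(v i, v j) \<in> set c \<or> (v j, v i) \<in> set c"
      using c(3) ij(3) unfolding has_chord_def by blast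
    moreover have "Suc l mod k < k" if "l < k" for l using that by simp
    ultimately show "j = Suc i mod k \<or> i = Suc j mod k"
      using index \<open>inj_on v {..<k}\<close> ij(1,2) unfolding inj_on_def by (metis lessThan_iff)
  qed
  then show ?thesis by blast
qed

section \<open>Chordality of the second power\<close>

theorem proposition4p7:
  fixes G :: "'a pair_pre_digraph"
  assumes "pair_graph G"
    and "no_isolated_vertices G"
    and "(\<forall>c. pre_digraph.cycle (with_proj G) c \<longrightarrow> length c \<le> 5)
         \<or> (claw_free G \<and> chordal G)"
  shows "chordal (second_power G)"
proof (rule ccontr)
  assume "\<not> chordal (second_power G)"
  then obtain v k where "square_hole G v k"
    using pair_graph.square_hole_if_not_chordal[OF assms(1)] by blast
  then interpret square_hole G v k .
  show False using assms(3) long_cycle not_chordal by fastforce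
qed

end
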